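(* Let $L$ be an algebra in $\mathcal V_2$ satisfying the density axiom D2 and the splitting axiom S2. Let $L_0$ be a finite subalgebra of $L$ and $L_1$ a finite algebra in $\mathcal V_2$ containing $L_0$ as a subalgebra. Then there exists an embedding of $L_1$ into $L$ which fixes every point of $L_0$.
   Context: A co-Heyting algebra is a bounded distributive lattice $(L,\mathbf{0},\mathbf{1},\vee,\wedge)$ with a binary operation $-$ such that $a-b$ is the least $c\in L$ with $a\le b\vee c$; embeddings and subalgebras are in the language $\{\mathbf 0,\mathbf 1,\vee,\wedge,-\}$. For $a,b\in L$ write $b\ll a$ iff $a-b=a$ and $b\le a$. $\mathcal V_2$ is the variety of co-Heyting algebras satisfying $(\mathbf 1-x)\wedge(\mathbf 1-(\mathbf 1-x))=\mathbf 0$. Axiom D2: for all $a,c$ with $c\ll a$ and $a\neq\mathbf 0$ there is $b\neq\mathbf 0$ with $c\ll b\ll a$. Axiom S2: for all $a,b_1,b_2$ with $b_1\vee b_2\ll a\ne\mathbf 0$ and $b_1\wedge b_2\wedge(\mathbf 1-(\mathbf 1-a))=\mathbf 0$ there are non-zero $a_1,a_2$ with $a-a_2=a_1\ge b_1$, $a-a_1=a_2\ge b_2$, and $a_1\wedge a_2=b_1\wedge b_2$. *)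

theory Defs
  imports Main
begin

unbundle lattice_syntax

text \<open>
  The signature is \<open>\<bottom>, \<top>, \<squnion>, \<sqinter>, -\<close>; the two axioms say that \<open>a - b\<close> is the least
  \<open>c\<close> with \<open>a \<le> b \<squnion> c\<close>. The one-element algebra (\<open>\<bottom> = \<top>\<close>) is allowed.
\<close>

class co_heyting_algebra = distrib_lattice + bounded_lattice + minus +
  assumes le_sup_diff: "a \<le> b \<squnion> (a - b)"
    and diff_least: "a \<le> b \<squnion> c \<Longrightarrow> a - b \<le> c"

class co_heyting_V2 = co_heyting_algebra +
  assumes V2: "(\<top> - x) \<sqinter> (\<top> - (\<top> - x)) = \<bottom>"

definition strongly_below :: "'a::co_heyting_algebra \<Rightarrow> 'a \<Rightarrow> bool"  (infix "\<lless>" 50)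
  where "b \<lless> a \<longleftrightarrow> a - b = a \<and> b \<le> a"

text \<open>The argument of type \<^typ>\<open>'a itself\<close> only names the algebra the axiom is about.\<close>

definition axiom_D2 :: "'a::co_heyting_algebra itself \<Rightarrow> bool"
  where "axiom_D2 _ \<longleftrightarrow>
    (\<forall>a c :: 'a. c \<lless> a \<and> a \<noteq> \<bottom> \<longrightarrow> (\<exists>b. b \<noteq> \<bottom> \<and> c \<lless> b \<and> b \<lless> a))"

definition axiom_S2 :: "'a::co_heyting_algebra itself \<Rightarrow> bool"
  where "axiom_S2 _ \<longleftrightarrow>
    (\<forall>a b1 b2 :: 'a.
      b1 \<squnion> b2 \<lless> a \<and> a \<noteq> \<bottom> \<and> b1 \<sqinter> b2 \<sqinter> (\<top> - (\<top> - a)) = \<bottom> \<longrightarrow>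
      (\<exists>a1 a2. a1 \<noteq> \<bottom> \<and> a2 \<noteq> \<bottom> \<and>
        a - a2 = a1 \<and> b1 \<le> a1 \<and>
        a - a1 = a2 \<and> b2 \<le> a2 \<and>
        a1 \<sqinter> a2 = b1 \<sqinter> b2))"

definition subalgebra :: "'a::co_heyting_algebra set \<Rightarrow> bool"
  where "subalgebra S \<longleftrightarrow> \<bottom> \<in> S \<and> \<top> \<in> S \<and>
    (\<forall>x\<in>S. \<forall>y\<in>S. x \<squnion> y \<in> S \<and> x \<sqinter> y \<in> S \<and> x - y \<in> S)"

text \<open>Meant for a subalgebra \<open>S\<close>, possibly all of \<^term>\<open>UNIV\<close>; values outside \<open>S\<close> are irrelevant.\<close>

definition embedding_on ::
    "'a::co_heyting_algebra set \<Rightarrow> ('a \<Rightarrow> 'b::co_heyting_algebra) \<Rightarrow> bool"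
  where "embedding_on S f \<longleftrightarrow> inj_on f S \<and> f \<bottom> = \<bottom> \<and> f \<top> = \<top> \<and>
    (\<forall>x\<in>S. \<forall>y\<in>S.
      f (x \<squnion> y) = f x \<squnion> f y \<and> f (x \<sqinter> y) = f x \<sqinter> f y \<and> f (x - y) = f x - f y)"

end

theory Submission
  imports Defs
begin

text \<open>
  Finite algebras are handled from the bottom up: an embedding of the principal ideal below \<open>d\<close>
  extends to the ideal below \<open>d \<squnion> p\<close>, for \<open>p\<close> minimal outside the ideal, as soon as some \<open>z \<noteq> \<bottom>\<close> of
  \<open>L\<close> satisfies \<open>z \<sqinter> h d = h (p \<sqinter> d) \<lless> z\<close>. The ideals below the elements of \<open>L\<^sub>0\<close> are filled one
  join-irreducible \<open>g\<close> of \<open>L\<^sub>0\<close> at a time, in two rounds. The join-irreducibles of \<open>L\<^sub>1\<close> below \<open>g\<close>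
  that are strongly below \<open>g\<close> get as image one half of an element that D2 inserts strongly below
  \<open>g\<close> and S2 splits. The maximal ones then receive the pieces into which S2 successively cuts
  \<open>g\<close> itself. The side condition of S2 holds because either \<open>\<top> - g = \<top>\<close>, or \<open>g\<close> is complemented
  and the law of \<open>\<V>\<^sub>2\<close> makes the maximal join-irreducibles below \<open>g\<close> disjoint.
\<close>

section \<open>Co-Heyting algebras\<close>

context co_heyting_algebra
begin

lemma diff_le_iff_le_sup: "a - b \<le> c \<longleftrightarrow> a \<le> b \<squnion> c"
  using le_sup_diff[of a b] diff_least[of a b c]
  by (meson order_trans sup.mono order_refl)

lemma diff_le_self: "a - b \<le> a"
  by (simp add: diff_le_iff_le_sup)

lemma diff_mono_left: "a \<le> b \<Longrightarrow> a - c \<le> b - c"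
  by (meson diff_le_iff_le_sup le_sup_diff order_trans)

lemma diff_antimono_right: "b \<le> c \<Longrightarrow> a - c \<le> a - b"
  by (meson diff_le_iff_le_sup le_sup_diff order_trans sup.mono order_refl)

lemma diff_eq_bot_iff: "a - b = \<bottom> \<longleftrightarrow> a \<le> b"
  using diff_le_iff_le_sup[of a b \<bottom>] by (simp add: bot_unique)

lemma diff_self_eq_bot: "a - a = \<bottom>"
  by (simp add: diff_eq_bot_iff)

lemma diff_diff: "(a - b) - c = a - (b \<squnion> c)"
  by (rule order.antisym) (metis diff_le_iff_le_sup sup_assoc order_refl)+

lemma diff_diff_commute: "(a - b) - c = (a - c) - b"
  by (simp add: diff_diff sup_commute)

lemma sup_diff: "(a \<squnion> b) - c = (a - c) \<squnion> (b - c)"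
proof (rule order.antisym)
  have "a \<squnion> b \<le> (c \<squnion> (a - c)) \<squnion> (c \<squnion> (b - c))"
    by (intro sup.mono le_sup_diff)
  then show "(a \<squnion> b) - c \<le> (a - c) \<squnion> (b - c)"
    by (simp add: diff_le_iff_le_sup ac_simps)
qed (simp add: diff_mono_left)

lemma diff_inf_self: "a - (a \<sqinter> b) = a - b"
proof (rule order.antisym)
  have "a \<le> (a \<sqinter> b) \<squnion> (a - b)"
    using le_sup_diff[of a b] by (simp add: sup_inf_distrib2 diff_le_self)
  then show "a - (a \<sqinter> b) \<le> a - b" by (rule diff_least)
qed (simp add: diff_antimono_right)

lemma sup_diff_absorb: "b \<le> a \<Longrightarrow> b \<squnion> (a - b) = a"
  by (simp add: order.antisym diff_le_self le_sup_diff)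

lemma diff_eq_self_mono: "b \<le> c \<Longrightarrow> a - c = a \<Longrightarrow> a - b = a"
  by (metis diff_antimono_right diff_le_self order.antisym)

lemma diff_eq_self_if_le_diff: "b \<le> a - b \<Longrightarrow> a - b = a"
  by (metis diff_le_self le_sup_diff order.antisym sup.absorb2)

end

lemma obtain_minimal_not_le:
  fixes S :: "'a::order set"
  assumes "finite S" "e \<in> S" "\<not> e \<le> d"
  obtains p where "p \<in> S" "p \<le> e" "\<not> p \<le> d" "\<And>y. y \<in> S \<Longrightarrow> y < p \<Longrightarrow> y \<le> d"
proof -
  let ?A = "{p \<in> S. p \<le> e \<and> \<not> p \<le> d}"
  have "finite ?A" "?A \<noteq> {}"
    using assms by auto
  then obtain p where p: "p \<in> ?A" "\<And>y. y \<in> ?A \<Longrightarrow> y \<le> p \<Longrightarrow> p = y"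
    using finite_has_minimal[of ?A] by blast
  have "y \<le> d" if "y \<in> S" "y < p" for y
    using p that by fastforce
  with p(1) show thesis
    using that by auto
qed

section \<open>Extending embeddings of principal ideals\<close>

text \<open>Maps are total, but only their values on the ideal matter, and \<open>h d\<close> need
  not be \<open>\<top>\<close>. A trivial kernel stands in for injectivity, because
  \<open>x \<le> y\<close> iff \<open>x - y = \<bottom>\<close>.\<close>

definition ideal_embedding ::
    "'b::co_heyting_algebra \<Rightarrow> ('b \<Rightarrow> 'a::co_heyting_algebra) \<Rightarrow> bool"
  where "ideal_embedding d h \<longleftrightarrow> (\<forall>x\<le>d. h x = \<bottom> \<longleftrightarrow> x = \<bottom>) \<and>
    (\<forall>x\<le>d. \<forall>y\<le>d. h (x \<squnion> y) = h x \<squnion> h y \<and> h (x \<sqinter> y) = h x \<sqinter> h y \<and> h (x - y) = h x - h y)"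

lemma ideal_embeddingD:
  assumes "ideal_embedding d h"
  shows "x \<le> d \<Longrightarrow> h x = \<bottom> \<longleftrightarrow> x = \<bottom>"
    and "x \<le> d \<Longrightarrow> y \<le> d \<Longrightarrow> h (x \<squnion> y) = h x \<squnion> h y"
    and "x \<le> d \<Longrightarrow> y \<le> d \<Longrightarrow> h (x \<sqinter> y) = h x \<sqinter> h y"
    and "x \<le> d \<Longrightarrow> y \<le> d \<Longrightarrow> h (x - y) = h x - h y"
  using assms by (auto simp: ideal_embedding_def)

lemma ideal_embedding_mono:
  assumes "ideal_embedding d h" "x \<le> y" "y \<le> d"
  shows "h x \<le> h y"
  using ideal_embeddingD(2)[OF assms(1), of x y] assms(2,3)
  by (metis order_trans sup.absorb2 sup.cobounded1)

lemma ideal_embedding_top_embedding_on: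
  assumes "ideal_embedding \<top> h" "h \<top> = \<top>"
  shows "embedding_on UNIV h"
proof -
  have "x \<le> y" if "h x = h y" for x y
    using ideal_embeddingD(1,4)[OF assms(1)] that by (metis diff_eq_bot_iff order_refl top_greatest)
  then have "inj h"
    by (metis injI order.antisym)
  then show ?thesis
    using assms ideal_embeddingD[OF assms(1)] by (auto simp: embedding_on_def)
qed

text \<open>When \<open>p\<close> is minimal outside the ideal, an element below
  \<open>d \<squnion> p\<close> is determined by its meet with \<open>d\<close> and by whether it
  lies above \<open>p\<close>; so the value \<open>z\<close> for \<open>p\<close> dictates the
  extension.\<close>

definition extend_map ::
    "'b::co_heyting_algebra \<Rightarrow> ('b \<Rightarrow> 'a::co_heyting_algebra) \<Rightarrow> 'b \<Rightarrow> 'a \<Rightarrow> 'b \<Rightarrow> 'a"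
  where "extend_map d h p z y = h (y \<sqinter> d) \<squnion> (if p \<le> y then z else \<bottom>)"

locale minimal_outside =
  fixes d p :: "'b::co_heyting_algebra"
  assumes not_le: "\<not> p \<le> d"
    and less_imp_le: "y < p \<Longrightarrow> y \<le> d"
begin

text \<open>Minimality makes \<open>p\<close> join-prime: otherwise \<open>p \<sqinter> x\<close>
  and \<open>p \<sqinter> y\<close> would both be proper, hence below \<open>d\<close>, and so would
  their join \<open>p\<close>.\<close>

lemma le_sup_iff: "p \<le> x \<squnion> y \<longleftrightarrow> p \<le> x \<or> p \<le> y"
proof
  assume "p \<le> x \<squnion> y"
  then have eq: "p = (p \<sqinter> x) \<squnion> (p \<sqinter> y)"
    by (metis inf.absorb1 inf_sup_distrib1)
  show "p \<le> x \<or> p \<le> y"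
  proof (rule ccontr)
    assume "\<not> (p \<le> x \<or> p \<le> y)"
    then have "p \<sqinter> x < p" "p \<sqinter> y < p"
      by (auto simp: less_le inf.absorb_iff1[symmetric])
    then show False
      using less_imp_le eq not_le by (metis le_sup_iff)
  qed
qed (auto intro: le_supI1 le_supI2)

lemma inf_le: "\<not> p \<le> y \<Longrightarrow> p \<sqinter> y \<le> d"
  by (metis inf.cobounded1 inf.absorb_iff1 less_imp_le less_le)

lemma diff_eq_self: "\<not> p \<le> y \<Longrightarrow> p - y = p"
  by (meson diff_le_self le_sup_diff le_sup_iff order.antisym)

lemma below_sup_cases:
  assumes "y \<le> d \<squnion> p"
  shows "y = (y \<sqinter> d) \<squnion> (if p \<le> y then p else \<bottom>)"
proof -
  have "y = (y \<sqinter> d) \<squnion> (y \<sqinter> p)"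
    using assms by (metis inf.absorb1 inf_sup_distrib1)
  moreover have "y \<sqinter> p \<le> y \<sqinter> d" if "\<not> p \<le> y"
    using inf_le[OF that] by (simp add: inf_commute)
  ultimately show ?thesis
    by (metis inf.absorb2 sup.absorb1 sup_bot_right)
qed

lemma extend_map_below: "y \<le> d \<Longrightarrow> extend_map d h p z y = h y"
  using not_le by (auto simp: extend_map_def inf.absorb1)

lemma extend_map_sup_self:
  assumes "ideal_embedding d h" "h (p \<sqinter> d) \<le> z" "y \<le> d"
  shows "extend_map d h p z (y \<squnion> p) = h y \<squnion> z"
proof -
  have "h ((y \<squnion> p) \<sqinter> d) = h y \<squnion> h (p \<sqinter> d)"
    using assms(3) ideal_embeddingD(2)[OF assms(1), of y "p \<sqinter> d"]
    by (simp add: inf_sup_distrib2 inf.absorb1)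
  then show ?thesis
    using assms(2) by (simp add: extend_map_def sup_assoc sup.absorb2)
qed

text \<open>Joins survive because \<open>p\<close> is join-prime. In a meet, the cross term
  \<open>z \<sqinter> h (y \<sqinter> d)\<close> is already a value of \<open>h\<close> and is
  absorbed. For differences, \<open>p - y\<close> is \<open>p\<close> or \<open>\<bottom>\<close>;
  when it is \<open>p\<close>, \<open>h (p \<sqinter> d) \<lless> z\<close> keeps \<open>z\<close>
  unchanged.\<close>

lemma ideal_embedding_extend_map:
  fixes h :: "'b \<Rightarrow> 'a::co_heyting_algebra"
  assumes emb: "ideal_embedding d h"
    and meet: "z \<sqinter> h d = h (p \<sqinter> d)" and below: "h (p \<sqinter> d) \<lless> z" and "z \<noteq> \<bottom>"
  shows "ideal_embedding (d \<squnion> p) (extend_map d h p z)"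
proof -
  let ?k = "extend_map d h p z"
  note D = ideal_embeddingD[OF emb]
  have z_diff: "z - h (p \<sqinter> d) = z" and z_ge: "h (p \<sqinter> d) \<le> z"
    using below by (auto simp: strongly_below_def)
  have sup: "?k (x \<squnion> y) = ?k x \<squnion> ?k y" for x y
  proof -
    have "h ((x \<squnion> y) \<sqinter> d) = h (x \<sqinter> d) \<squnion> h (y \<sqinter> d)"
      using D(2)[of "x \<sqinter> d" "y \<sqinter> d"] by (simp add: inf_sup_distrib2)
    then show ?thesis
      by (auto simp: extend_map_def le_sup_iff ac_simps)
  qed
  have meet_z: "z \<sqinter> h (y \<sqinter> d) = h (p \<sqinter> d \<sqinter> (y \<sqinter> d))" for y
  proof -
    have "h (y \<sqinter> d) \<le> h d"
      using ideal_embedding_mono[OF emb] by simp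
    then have "z \<sqinter> h (y \<sqinter> d) = z \<sqinter> h d \<sqinter> h (y \<sqinter> d)"
      by (simp add: inf_assoc inf.absorb2)
    then show ?thesis
      using D(3)[of "p \<sqinter> d" "y \<sqinter> d"] meet by simp
  qed
  have inf: "?k (x \<sqinter> y) = ?k x \<sqinter> ?k y" for x y
  proof -
    have hh: "h (x \<sqinter> d) \<sqinter> h (y \<sqinter> d) = h (x \<sqinter> y \<sqinter> d)"
      using D(3)[of "x \<sqinter> d" "y \<sqinter> d"] by (simp add: ac_simps)
    have absorb: "z \<sqinter> h (v \<sqinter> d) \<le> h (u \<sqinter> v \<sqinter> d)" if "p \<le> u" for u v
      unfolding meet_z using that
      by (intro ideal_embedding_mono[OF emb]) (auto intro: le_infI1 le_infI2)
    note ab = absorb[of x y] absorb[of y x]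
    consider "p \<le> x" "p \<le> y" | "p \<le> x" "\<not> p \<le> y" | "\<not> p \<le> x" "p \<le> y" | "\<not> p \<le> x" "\<not> p \<le> y"
      by blast
    then show ?thesis
    proof cases
      case 1
      have "(h (x \<sqinter> d) \<squnion> z) \<sqinter> (h (y \<sqinter> d) \<squnion> z) = h (x \<sqinter> y \<sqinter> d) \<squnion> z"
        by (simp add: hh sup_inf_distrib2[symmetric])
      with 1 show ?thesis by (simp add: extend_map_def)
    next
      case 2
      then show ?thesis using ab
        by (simp add: extend_map_def inf_sup_distrib2 hh sup.absorb1)
    next
      case 3
      then have "h (x \<sqinter> d) \<sqinter> z \<le> h (x \<sqinter> y \<sqinter> d)"
        using ab by (simp add: inf_commute)
      with 3 show ?thesis
        by (simp add: extend_map_def inf_sup_distrib1 hh sup.absorb1)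
    next
      case 4
      then show ?thesis by (simp add: extend_map_def hh)
    qed
  qed
  have k_p: "?k p = z"
    using z_ge by (simp add: extend_map_def sup.absorb2)
  have k_bot: "?k \<bottom> = \<bottom>"
    using D(1)[of \<bottom>] extend_map_below[of \<bottom> h z] by simp
  have zero: "x = \<bottom>" if "?k x = \<bottom>" "x \<le> d \<squnion> p" for x
    using that below_sup_cases[OF that(2)] D(1)[of "x \<sqinter> d"] \<open>z \<noteq> \<bottom>\<close>
    by (auto simp: extend_map_def split: if_splits)
  \<comment> \<open>Replacing \<open>y\<close> by \<open>u \<sqinter> y\<close> on both sides trades
    an arbitrary \<open>y\<close> for an element below \<open>d\<close>, where \<open>h\<close>
    respects differences.\<close>
  have diff_d: "?k (u - y) = ?k u - ?k y" if "u \<le> d" for u y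
  proof -
    have "?k (u - y) = h (u - u \<sqinter> y)"
      using extend_map_below[of "u - y"] order_trans[OF diff_le_self that]
      by (simp add: diff_inf_self)
    also have "\<dots> = h u - h (u \<sqinter> y)"
      using D(4)[of u "u \<sqinter> y"] that by (simp add: le_infI1)
    also have "\<dots> = ?k u - ?k (u \<sqinter> y)"
      using that by (simp add: extend_map_below le_infI1)
    finally show ?thesis by (simp add: inf diff_inf_self)
  qed
  have diff_p: "?k (p - y) = ?k p - ?k y" for y
  proof (cases "p \<le> y")
    case True
    then have "?k p \<le> ?k y"
      by (metis inf inf.absorb_iff1)
    then show ?thesis
      using True k_bot by (metis diff_eq_bot_iff)
  next
    case False
    then have "?k (p \<sqinter> y) \<le> h (p \<sqinter> d)"
      using inf_le by (simp add: extend_map_below ideal_embedding_mono[OF emb])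
    then have "z - ?k (p \<sqinter> y) = z"
      using z_diff by (rule diff_eq_self_mono)
    then show ?thesis
      by (simp add: diff_eq_self[OF False] inf k_p diff_inf_self)
  qed
  have diff: "?k (x - y) = ?k x - ?k y" if "x \<le> d \<squnion> p" for x y
  proof (cases "p \<le> x")
    case True
    then have x: "x = (x \<sqinter> d) \<squnion> p"
      using below_sup_cases[OF that] by simp
    have "?k (((x \<sqinter> d) \<squnion> p) - y) = ?k ((x \<sqinter> d) \<squnion> p) - ?k y"
      by (simp add: sup sup_diff diff_d diff_p)
    then show ?thesis using x by simp
  next
    case False
    then have "x \<le> d"
      using below_sup_cases[OF that] by (simp add: inf.absorb_iff1)
    then show ?thesis by (rule diff_d)
  qed
  show ?thesis
    unfolding ideal_embedding_def using sup inf diff zero k_bot by blast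
qed

end

section \<open>Density and splitting\<close>

text \<open>Here \<open>b \<le> a = a - b \<le> \<top> - b\<close>. Hence
  \<open>\<top> - (\<top> - b) = \<bottom>\<close>, which settles the side condition of S2 when
  \<open>b\<close> is to be split.\<close>

lemma strongly_below_top:
  fixes a :: "'a::co_heyting_algebra"
  assumes "b \<lless> a"
  shows "\<top> - b = \<top>"
proof (rule diff_eq_self_if_le_diff)
  show "b \<le> \<top> - b"
    using assms diff_mono_left[of a \<top> b] by (auto simp: strongly_below_def)
qed

text \<open>Each half is \<open>a\<close> minus the other, and removals commute, so
  \<open>a - b1 = a\<close> passes to \<open>a1\<close>. A cross term such as
  \<open>a1 \<sqinter> b2\<close> lies in \<open>a1 \<sqinter> a2 = b1 \<sqinter> b2\<close>; this
  yields the meets that \<open>ideal_embedding_extend_map\<close> asks for.\<close>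

lemma split_strongly_below:
  fixes a :: "'a::co_heyting_algebra"
  assumes "axiom_S2 TYPE('a)" "b1 \<squnion> b2 \<lless> a" "a \<noteq> \<bottom>" "b1 \<sqinter> b2 \<sqinter> (\<top> - (\<top> - a)) = \<bottom>"
  obtains a1 a2 where "a1 \<noteq> \<bottom>" "a2 \<noteq> \<bottom>" "a1 \<squnion> a2 = a" "a1 \<sqinter> a2 = b1 \<sqinter> b2"
    "b1 \<lless> a1" "b2 \<lless> a2" "a1 \<sqinter> (b1 \<squnion> b2) = b1" "a2 \<sqinter> (b1 \<squnion> b2) = b2"
proof -
  obtain a1 a2 where a: "a1 \<noteq> \<bottom>" "a2 \<noteq> \<bottom>" "a - a2 = a1" "b1 \<le> a1" "a - a1 = a2" "b2 \<le> a2"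
    and meet: "a1 \<sqinter> a2 = b1 \<sqinter> b2"
    using assms unfolding axiom_S2_def by blast
  have "a1 \<le> a" using a diff_le_self by blast
  then have join: "a1 \<squnion> a2 = a"
    using a sup_diff_absorb by metis
  have "a - (b1 \<squnion> b2) = a"
    using assms(2) by (simp add: strongly_below_def)
  then have b: "a - b1 = a" "a - b2 = a"
    using diff_eq_self_mono by (metis sup_ge1, metis sup_ge2)
  then have "a1 - b1 = a1" "a2 - b2 = a2"
    using a by (metis diff_diff_commute)+
  then have sb: "b1 \<lless> a1" "b2 \<lless> a2"
    using a by (auto simp: strongly_below_def)
  have "a1 \<sqinter> b2 \<le> a1 \<sqinter> a2" "a2 \<sqinter> b1 \<le> a1 \<sqinter> a2"
    using a by (auto intro: le_infI1 le_infI2)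
  then have "a1 \<sqinter> b2 \<le> b1" "a2 \<sqinter> b1 \<le> b2"
    using meet by auto
  then have "a1 \<sqinter> (b1 \<squnion> b2) = b1" "a2 \<sqinter> (b1 \<squnion> b2) = b2"
    using a by (auto simp: inf_sup_distrib1 inf.absorb2 sup.absorb1 sup.absorb2)
  with a(1,2) join meet sb show thesis
    by (rule that)
qed

text \<open>D2 puts \<open>t\<close> between \<open>s\<close> and \<open>g\<close>; S2 splits
  \<open>t\<close> over \<open>b\<close> and \<open>s\<close>, whose join is \<open>s\<close>, and
  \<open>z\<close> is the half over \<open>b\<close>.\<close>

lemma insert_strongly_below:
  fixes g :: "'a::co_heyting_algebra"
  assumes "axiom_D2 TYPE('a)" "axiom_S2 TYPE('a)" "s \<lless> g" "g \<noteq> \<bottom>" "b \<le> s"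
  obtains z where "z \<noteq> \<bottom>" "b \<lless> z" "z \<lless> g" "z \<sqinter> s = b"
proof -
  obtain t where t: "t \<noteq> \<bottom>" "s \<lless> t" "t \<lless> g"
    using assms unfolding axiom_D2_def by blast
  have bs: "b \<squnion> s = s" using assms(5) by (rule sup.absorb2)
  have "\<top> - (\<top> - t) = \<bottom>"
    by (simp add: strongly_below_top[OF t(3)] diff_self_eq_bot)
  then have "b \<sqinter> s \<sqinter> (\<top> - (\<top> - t)) = \<bottom>" by simp
  then obtain z w where z: "z \<noteq> \<bottom>" "z \<squnion> w = t" "b \<lless> z" "z \<sqinter> (b \<squnion> s) = b"
    using split_strongly_below[OF assms(2), of b s t] t(1,2) unfolding bs by metis
  have "z \<le> t" using z by auto
  then have "z \<lless> g"
    using t(3) unfolding strongly_below_def by (meson diff_eq_self_mono order_trans)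
  with z bs show thesis
    using that by auto
qed

section \<open>Adding one join-irreducible of the subalgebra\<close>

text \<open>
  In \<open>join_irreducible_step\<close>, \<open>e\<close> and \<open>g\<close> are taken from \<open>L\<^sub>0\<close> and \<open>E\<close> and \<open>G\<close> are their images
  in \<open>L\<^sub>1\<close>; the embedding \<open>h\<^sub>0\<close> of the ideal below \<open>E\<close> is to be extended to \<open>E \<squnion> G\<close>.
\<close>

locale join_irreducible_step =
  fixes h0 :: "'b::{co_heyting_V2, finite} \<Rightarrow> 'a::co_heyting_algebra"
    and E G :: 'b and e g :: 'a
  assumes D2: "axiom_D2 TYPE('a)" and S2: "axiom_S2 TYPE('a)"
    and emb0: "ideal_embedding E h0"
    and h0_E: "h0 E = e" and h0_inf: "h0 (E \<sqinter> G) = e \<sqinter> g"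
    and g_diff: "g - e = g" and G_diff: "G - E = G"
    and g_nz: "g \<noteq> \<bottom>" and G_nz: "G \<noteq> \<bottom>"
    and top_or_complemented: "\<top> - g = \<top> \<or> G \<sqinter> (\<top> - G) = \<bottom>"
begin

definition extends :: "'b \<Rightarrow> ('b \<Rightarrow> 'a) \<Rightarrow> bool"
  where "extends d h \<longleftrightarrow> E \<le> d \<and> d \<le> E \<squnion> G \<and> ideal_embedding d h \<and> (\<forall>y\<le>E. h y = h0 y)"

lemma extends_extend_map:
  assumes "extends d h" "minimal_outside d p" "p \<le> G"
    and "z \<sqinter> h d = h (p \<sqinter> d)" "h (p \<sqinter> d) \<lless> z" "z \<noteq> \<bottom>"
  shows "extends (d \<squnion> p) (extend_map d h p z)"
    and "extend_map d h p z ((d \<squnion> p) \<sqinter> G) = h (d \<sqinter> G) \<squnion> z"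
proof -
  interpret minimal_outside d p by fact
  have ex: "E \<le> d" "d \<le> E \<squnion> G" "ideal_embedding d h" "\<And>y. y \<le> E \<Longrightarrow> h y = h0 y"
    using assms(1) by (auto simp: extends_def)
  have "extend_map d h p z y = h0 y" if "y \<le> E" for y
    using ex(4)[OF that] extend_map_below[OF order_trans[OF that ex(1)], of h z] by simp
  then show "extends (d \<squnion> p) (extend_map d h p z)"
    using ex assms(3) ideal_embedding_extend_map[OF ex(3) assms(4-6)]
    by (auto simp: extends_def intro: le_supI1 le_supI2)
  have "(d \<squnion> p) \<sqinter> G = (d \<sqinter> G) \<squnion> p"
    using assms(3) by (simp add: inf_sup_distrib2 inf.absorb1)
  then show "extend_map d h p z ((d \<squnion> p) \<sqinter> G) = h (d \<sqinter> G) \<squnion> z"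
    using extend_map_sup_self[OF ex(3), of z "d \<sqinter> G"] assms(5) by (simp add: strongly_below_def)
qed

text \<open>Since \<open>d = E \<squnion> (d \<sqinter> G)\<close> and \<open>e \<sqinter> g\<close>
  is already the image of \<open>E \<sqinter> G\<close>, the old part \<open>e\<close> adds nothing
  below \<open>g\<close>. New values need comparing only with
  \<open>h (d \<sqinter> G)\<close>.\<close>

lemma extends_inf:
  assumes "extends d h" "z \<le> g"
  shows "z \<sqinter> h d = z \<sqinter> h (d \<sqinter> G)"
proof -
  have ex: "E \<le> d" "d \<le> E \<squnion> G" "ideal_embedding d h" "\<And>y. y \<le> E \<Longrightarrow> h y = h0 y"
    using assms(1) by (auto simp: extends_def)
  have "d = E \<squnion> (d \<sqinter> G)"
    using ex by (metis inf.absorb1 inf.absorb2 inf_sup_distrib1)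
  then have "h d = h E \<squnion> h (d \<sqinter> G)"
    using ex ideal_embeddingD(2)[OF ex(3), of E "d \<sqinter> G"] by simp
  then have hd: "h d = e \<squnion> h (d \<sqinter> G)"
    using ex(4) h0_E by simp
  have "z \<sqinter> e \<le> h (E \<sqinter> G)"
    using ex(4)[of "E \<sqinter> G"] h0_inf assms(2) by (simp add: le_infI1)
  also have "\<dots> \<le> h (d \<sqinter> G)"
    using ideal_embedding_mono[OF ex(3)] ex(1) by (simp add: le_infI1)
  finally show ?thesis
    by (simp add: hd inf_sup_distrib1 sup.absorb2)
qed

text \<open>Take \<open>d\<close> maximal with the first three properties. A minimal
  \<open>p\<close> outside it and below some \<open>y \<lless> G\<close> is itself strongly below
  \<open>G\<close>, and \<open>insert_strongly_below\<close> supplies its image; the properties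
  survive because successive removals still leave \<open>G\<close> and \<open>g\<close>
  unchanged.\<close>

lemma fill_strongly_below:
  obtains d h where "extends d h" "G - d = G" "h (d \<sqinter> G) \<lless> g" "\<And>y. y \<lless> G \<Longrightarrow> y \<le> d"
proof -
  let ?A = "{d. \<exists>h. extends d h \<and> G - d = G \<and> h (d \<sqinter> G) \<lless> g}"
  have "g - (e \<sqinter> g) = g"
    by (rule diff_eq_self_mono[OF inf_le1 g_diff])
  then have "extends E h0 \<and> G - E = G \<and> h0 (E \<sqinter> G) \<lless> g"
    using emb0 G_diff by (simp add: extends_def strongly_below_def h0_inf)
  then have "?A \<noteq> {}" by blast
  from finite_has_maximal[OF finite this]
  obtain d where "d \<in> ?A" and max: "\<forall>d'\<in>?A. d \<le> d' \<longrightarrow> d = d'"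
    by (rule bexE)
  then obtain h where ext: "extends d h" and Gd: "G - d = G" and sg: "h (d \<sqinter> G) \<lless> g"
    by blast
  have "y \<le> d" if y: "y \<lless> G" for y
  proof (rule ccontr)
    assume "\<not> y \<le> d"
    then obtain p where p: "p \<le> y" "\<not> p \<le> d" "\<And>x. x < p \<Longrightarrow> x \<le> d"
      using obtain_minimal_not_le[of UNIV y d] by auto
    then have mo: "minimal_outside d p"
      by unfold_locales
    have emb: "ideal_embedding d h" using ext by (simp add: extends_def)
    have pG: "p \<le> G" and Gp: "G - p = G"
      using p(1) y diff_eq_self_mono by (auto simp: strongly_below_def)
    have "h (p \<sqinter> d) \<le> h (d \<sqinter> G)"
      using pG by (intro ideal_embedding_mono[OF emb]) (auto intro: le_infI1 le_infI2)
    then obtain z where z: "z \<noteq> \<bottom>" "h (p \<sqinter> d) \<lless> z" "z \<lless> g" "z \<sqinter> h (d \<sqinter> G) = h (p \<sqinter> d)"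
      using insert_strongly_below[OF D2 S2 sg g_nz] by blast
    then have "z \<sqinter> h d = h (p \<sqinter> d)"
      using extends_inf[OF ext] by (simp add: strongly_below_def)
    note ext' = extends_extend_map[OF ext mo pG this z(2,1)]
    have "G - (d \<squnion> p) = G"
      using Gd Gp by (simp add: diff_diff[symmetric])
    moreover have "h (d \<sqinter> G) \<squnion> z \<lless> g"
      using sg z(3) by (simp add: strongly_below_def diff_diff[symmetric])
    ultimately have "d \<squnion> p \<in> ?A"
      using ext' by (metis (mono_tags, lifting) mem_Collect_eq)
    then show False
      using bspec[OF max, of "d \<squnion> p"] p(2) by (metis sup_ge1 sup_ge2)
  qed
  with ext Gd sg show thesis
    by (rule that)
qed

text \<open>
  Invariant of the second round: \<open>G - d\<close> is generated by the maximal join-irreducibles below \<open>G\<close>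
  that have no image yet, and \<open>a\<close> is the part of \<open>g\<close> left for them.
\<close>

definition splitting_state :: "'b \<Rightarrow> ('b \<Rightarrow> 'a) \<Rightarrow> 'a \<Rightarrow> bool"
  where "splitting_state d h a \<longleftrightarrow> extends d h \<and> (\<forall>y. y \<lless> G \<longrightarrow> y \<le> d) \<and> G - d \<noteq> \<bottom> \<and>
    a \<noteq> \<bottom> \<and> h ((G - d) \<sqinter> d) \<lless> a \<and> a \<sqinter> h d = h ((G - d) \<sqinter> d) \<and> h (d \<sqinter> G) \<squnion> a = g"

text \<open>\<open>p \<le> \<top> - p\<close> would give \<open>\<top> - p = \<top>\<close>;
  restricted to the complemented \<open>G\<close> this says \<open>p \<lless> G\<close>, forcing
  \<open>p \<le> d\<close>. So the join-prime \<open>p\<close> lies below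
  \<open>\<top> - (\<top> - p)\<close>, and \<open>V2\<close> applies.\<close>

lemma maximal_disjoint:
  assumes "minimal_outside d p" "\<And>y. y \<lless> G \<Longrightarrow> y \<le> d" "p \<le> G" "G \<sqinter> (\<top> - G) = \<bottom>"
  shows "p \<sqinter> (\<top> - p) = \<bottom>"
proof -
  interpret minimal_outside d p by fact
  have "\<not> p \<le> \<top> - p"
  proof
    assume "p \<le> \<top> - p"
    then have "\<top> - p = \<top>" by (rule diff_eq_self_if_le_diff)
    moreover have "\<top> = G \<squnion> (\<top> - G)"
      by (simp add: sup_diff_absorb)
    ultimately have "\<top> = (G - p) \<squnion> ((\<top> - G) - p)"
      by (metis sup_diff)
    also have "\<dots> \<le> (G - p) \<squnion> (\<top> - G)"
      by (intro sup.mono order_refl diff_le_self)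
    finally have "G \<le> (G - p) \<squnion> (\<top> - G)"
      by (simp add: top_unique)
    then have "G = G \<sqinter> (G - p)"
      using assms(4) by (metis inf.absorb1 inf_sup_distrib1 sup_bot_right)
    then have "G - p = G"
      by (metis diff_le_self inf.absorb2)
    then show False
      using assms(2)[of p] assms(3) not_le by (simp add: strongly_below_def)
  qed
  then have "p \<le> \<top> - (\<top> - p)"
    using diff_eq_self diff_mono_left[of p \<top> "\<top> - p"] by simp
  then have "p \<sqinter> (\<top> - p) \<le> (\<top> - p) \<sqinter> (\<top> - (\<top> - p))"
    by (simp add: le_infI1)
  then show ?thesis
    by (simp add: V2 bot_unique)
qed

text \<open>Some \<open>p \<le> G - d\<close> minimal outside \<open>d\<close> is treated next, and
  \<open>R'\<close> is what remains. If \<open>R' = \<bottom>\<close>, \<open>p\<close> receives all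
  of \<open>a\<close>; otherwise S2 cuts \<open>a\<close> into a piece for \<open>p\<close> and a
  new remainder for \<open>R'\<close>.\<close>

lemma splitting_state_step:
  assumes "splitting_state d h a"
  shows "(\<exists>d' h' a'. splitting_state d' h' a' \<and> d < d') \<or> (\<exists>h'. extends (E \<squnion> G) h' \<and> h' G = g)"
proof -
  let ?R = "G - d"
  have ext: "extends d h" and sat: "\<And>y. y \<lless> G \<Longrightarrow> y \<le> d" and "?R \<noteq> \<bottom>" and "a \<noteq> \<bottom>"
    and sa: "h (?R \<sqinter> d) \<lless> a" and ah: "a \<sqinter> h d = h (?R \<sqinter> d)" and ga: "h (d \<sqinter> G) \<squnion> a = g"
    using assms by (auto simp: splitting_state_def)
  have emb: "ideal_embedding d h" using ext by (simp add: extends_def)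
  have "\<not> ?R \<le> d"
    using \<open>?R \<noteq> \<bottom>\<close> by (metis diff_eq_bot_iff diff_le_iff_le_sup sup.idem)
  then obtain p where p: "p \<le> ?R" "\<not> p \<le> d" "\<And>x. x < p \<Longrightarrow> x \<le> d"
    using obtain_minimal_not_le[of UNIV ?R d] by auto
  then have mo: "minimal_outside d p"
    by unfold_locales
  interpret minimal_outside d p by fact
  have pG: "p \<le> G" using p(1) diff_le_self order_trans by blast
  define R' where "R' = ?R - p"
  have R': "R' = G - (d \<squnion> p)" by (simp add: R'_def diff_diff)
  have R_eq: "?R = p \<squnion> R'" using p(1) by (simp add: R'_def sup_diff_absorb)
  have lt: "d < d \<squnion> p" using p(2) by (metis less_le sup.absorb_iff1 sup_ge1)
  show ?thesis
  proof (cases "R' = \<bottom>")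
    case True
    then have "?R = p" using R_eq by simp
    then have "extends (d \<squnion> p) (extend_map d h p a)"
      and val: "extend_map d h p a ((d \<squnion> p) \<sqinter> G) = g"
      using extends_extend_map[OF ext mo pG] sa ah \<open>a \<noteq> \<bottom>\<close> ga by simp_all
    moreover have G_le: "G \<le> d \<squnion> p" using True R' by (simp add: diff_eq_bot_iff)
    moreover have "d \<squnion> p = E \<squnion> G"
      using ext G_le pG by (intro order.antisym) (auto simp: extends_def intro: le_supI1 le_supI2)
    ultimately show ?thesis by (auto simp: inf.absorb2)
  next
    case False
    \<comment> \<open>If it were, \<open>p\<close> would be strongly below \<open>G\<close> and
      hence already below \<open>d\<close>. So \<open>R'\<close> meets \<open>p\<close> only inside
      \<open>d\<close>.\<close>
    have pR': "\<not> p \<le> R'"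
    proof
      assume "p \<le> R'"
      also have "R' \<le> G - p"
        unfolding R' by (rule diff_antimono_right) simp
      finally have "p \<lless> G"
        using pG diff_eq_self_if_le_diff by (auto simp: strongly_below_def)
      then show False using sat p(2) by blast
    qed
    have join: "h (p \<sqinter> d) \<squnion> h (R' \<sqinter> d) = h (?R \<sqinter> d)"
      using ideal_embeddingD(2)[OF emb, of "p \<sqinter> d" "R' \<sqinter> d"] R_eq by (simp add: inf_sup_distrib2)
    have side: "h (p \<sqinter> d) \<sqinter> h (R' \<sqinter> d) \<sqinter> (\<top> - (\<top> - a)) = \<bottom>"
      using top_or_complemented
    proof
      assume "\<top> - g = \<top>"
      then have "\<top> - a = \<top>" using ga diff_eq_self_mono by (metis sup_ge2)
      then show ?thesis by (simp add: diff_self_eq_bot)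
    next
      assume "G \<sqinter> (\<top> - G) = \<bottom>"
      then have "p \<sqinter> (\<top> - p) = \<bottom>" using maximal_disjoint[OF mo sat pG] by blast
      moreover have "R' \<le> \<top> - p" by (simp add: R'_def diff_mono_left)
      ultimately have "p \<sqinter> R' = \<bottom>"
        by (metis bot_unique inf_mono order_refl)
      then have "(p \<sqinter> d) \<sqinter> (R' \<sqinter> d) = \<bottom>"
        by (metis inf_mono inf_le1 bot_unique)
      then have "h (p \<sqinter> d) \<sqinter> h (R' \<sqinter> d) = \<bottom>"
        using ideal_embeddingD(1,3)[OF emb] by (metis bot_least inf_le2)
      then show ?thesis by simp
    qed
    obtain a1 a2 where a: "a1 \<noteq> \<bottom>" "a2 \<noteq> \<bottom>" "a1 \<squnion> a2 = a"
      "a1 \<sqinter> a2 = h (p \<sqinter> d) \<sqinter> h (R' \<sqinter> d)" "h (p \<sqinter> d) \<lless> a1" "h (R' \<sqinter> d) \<lless> a2"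
      "a1 \<sqinter> h (?R \<sqinter> d) = h (p \<sqinter> d)" "a2 \<sqinter> h (?R \<sqinter> d) = h (R' \<sqinter> d)"
      using split_strongly_below[OF S2 _ \<open>a \<noteq> \<bottom>\<close> side] sa join by metis
    have "a1 \<le> a" "a2 \<le> a" using a(3) by auto
    then have "a1 \<sqinter> h d = a1 \<sqinter> (a \<sqinter> h d)" "a2 \<sqinter> h d = a2 \<sqinter> (a \<sqinter> h d)"
      by (simp_all add: inf_assoc[symmetric] inf.absorb1)
    then have m: "a1 \<sqinter> h d = h (p \<sqinter> d)" "a2 \<sqinter> h d = h (R' \<sqinter> d)"
      using a ah by simp_all
    let ?k = "extend_map d h p a1"
    have k: "extends (d \<squnion> p) ?k" "?k ((d \<squnion> p) \<sqinter> G) = h (d \<sqinter> G) \<squnion> a1"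
      using extends_extend_map[OF ext mo pG m(1) a(5,1)] by simp_all
    have "R' \<sqinter> p \<le> R' \<sqinter> d"
      using inf_le[OF pR'] by (simp add: inf_commute)
    then have "R' \<sqinter> (d \<squnion> p) = R' \<sqinter> d"
      by (simp add: inf_sup_distrib1 sup.absorb1)
    then have kR: "?k (R' \<sqinter> (d \<squnion> p)) = h (R' \<sqinter> d)"
      by (simp add: extend_map_below)
    have "?k (d \<squnion> p) = h d \<squnion> a1"
      using extend_map_sup_self[OF emb _ order_refl] a(5) by (simp add: strongly_below_def)
    \<comment> \<open>The pieces overlap only in
      \<open>h (p \<sqinter> d) \<sqinter> h (R' \<sqinter> d)\<close>, so the new value
      \<open>a1\<close> adds nothing to the meet with \<open>a2\<close>.\<close>
    then have "a2 \<sqinter> ?k (d \<squnion> p) = h (R' \<sqinter> d) \<squnion> (a1 \<sqinter> a2)"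
      using m by (simp add: inf_sup_distrib1 inf_commute)
    then have "a2 \<sqinter> ?k (d \<squnion> p) = h (R' \<sqinter> d)"
      using a(4) by (simp add: sup.absorb1)
    moreover have "h (d \<sqinter> G) \<squnion> a1 \<squnion> a2 = g"
      using a(3) ga by (simp add: sup_assoc)
    ultimately have "splitting_state (d \<squnion> p) ?k a2"
      unfolding splitting_state_def R'[symmetric]
      using k kR a False sat by (auto intro: le_supI1)
    then show ?thesis using lt by blast
  qed
qed

text \<open>The first round leaves \<open>G - d = G\<close>, so the second starts with all of
  \<open>g\<close> to distribute. A state with maximal \<open>d\<close> has no larger successor, so
  its step must finish the extension.\<close>

lemma ideal_embedding_sup:
  obtains h where "ideal_embedding (E \<squnion> G) h" "\<And>y. y \<le> E \<Longrightarrow> h y = h0 y" "h G = g"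
proof -
  let ?A = "{d. \<exists>h a. splitting_state d h a}"
  obtain d h where dh: "extends d h" "G - d = G" "h (d \<sqinter> G) \<lless> g" "\<And>y. y \<lless> G \<Longrightarrow> y \<le> d"
    using fill_strongly_below by blast
  have "g \<sqinter> h d = h (d \<sqinter> G)"
    using extends_inf[OF dh(1), of g] dh(3) by (simp add: strongly_below_def inf.absorb2)
  moreover have "h (d \<sqinter> G) \<squnion> g = g"
    using dh(3) by (simp add: strongly_below_def sup.absorb2)
  ultimately have "splitting_state d h g"
    using dh g_nz G_nz by (simp add: splitting_state_def inf_commute)
  then have "?A \<noteq> {}" by blast
  from finite_has_maximal[OF finite this]
  obtain d' where "d' \<in> ?A" and max: "\<forall>d''\<in>?A. d' \<le> d'' \<longrightarrow> d' = d''"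
    by (rule bexE)
  then obtain h' a' where "splitting_state d' h' a'"
    by blast
  moreover have "\<not> d' < d''" if "splitting_state d'' h'' a''" for d'' h'' a''
    using bspec[OF max, of d''] that by (auto simp: less_le)
  ultimately obtain k where "extends (E \<squnion> G) k" "k G = g"
    using splitting_state_step by blast
  then show thesis
    using that by (auto simp: extends_def)
qed

end

section \<open>The embedding theorem\<close>

lemma embedding_on_mono:
  assumes "embedding_on S f" "x \<in> S" "y \<in> S" "x \<le> y"
  shows "f x \<le> f y"
  using assms unfolding embedding_on_def by (metis sup.absorb2 sup_ge1)

text \<open>Minimality of \<open>g\<close> holds only within \<open>L0\<close>, and
  \<open>\<iota> g\<close> may be join-reducible. Hence the passage through
  \<open>join_irreducible_step\<close> instead of a single \<open>extend_map\<close>.\<close>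

lemma extend_over_join_irreducible:
  fixes L0 :: "'a::co_heyting_V2 set"
    and \<iota> :: "'a \<Rightarrow> 'b::{co_heyting_V2, finite}"
  assumes D2: "axiom_D2 TYPE('a)" and S2: "axiom_S2 TYPE('a)"
    and sub: "subalgebra L0" and emb: "embedding_on L0 \<iota>"
    and e: "e \<in> L0" and h0: "ideal_embedding (\<iota> e) h0" "\<And>x. x \<in> L0 \<Longrightarrow> x \<le> e \<Longrightarrow> h0 (\<iota> x) = x"
    and g: "g \<in> L0" "\<not> g \<le> e" "\<And>y. y \<in> L0 \<Longrightarrow> y < g \<Longrightarrow> y \<le> e"
  shows "\<exists>h. ideal_embedding (\<iota> (e \<squnion> g)) h \<and> (\<forall>x\<in>L0. x \<le> e \<squnion> g \<longrightarrow> h (\<iota> x) = x)"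
proof -
  have closed: "x \<squnion> y \<in> L0" "x \<sqinter> y \<in> L0" "x - y \<in> L0" if "x \<in> L0" "y \<in> L0" for x y
    using sub that by (auto simp: subalgebra_def)
  have bounds: "\<bottom> \<in> L0" "\<top> \<in> L0"
    using sub by (auto simp: subalgebra_def)
  have hom: "\<iota> (x \<squnion> y) = \<iota> x \<squnion> \<iota> y" "\<iota> (x \<sqinter> y) = \<iota> x \<sqinter> \<iota> y" "\<iota> (x - y) = \<iota> x - \<iota> y"
    if "x \<in> L0" "y \<in> L0" for x y
    using emb that by (auto simp: embedding_on_def)
  have inj: "inj_on \<iota> L0" and bot: "\<iota> \<bottom> = \<bottom>" and top: "\<iota> \<top> = \<top>"
    using emb by (auto simp: embedding_on_def)
  \<comment> \<open>\<open>g \<sqinter> w\<close> and \<open>g - w\<close> lie in \<open>L0\<close>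
    and join to \<open>g\<close>; were both proper, minimality would put them, and so
    \<open>g\<close>, below \<open>e\<close>.\<close>
  have g_diff: "g - w = g" if "w \<in> L0" "\<not> g \<le> w" for w
  proof (rule ccontr)
    assume "g - w \<noteq> g"
    then have "g - w < g" using diff_le_self by (simp add: less_le)
    then have "g - w \<le> e" using g(3) closed(3)[OF g(1) that(1)] by simp
    moreover have "g \<sqinter> w \<le> e"
      using g(3)[OF closed(2)[OF g(1) that(1)]] that(2)
      by (simp add: less_le inf.absorb_iff1[symmetric])
    moreover have "g = (g \<sqinter> w) \<squnion> (g - w)"
      by (metis diff_inf_self inf_le1 sup_diff_absorb)
    ultimately show False using g(2) by (metis le_sup_iff)
  qed
  have g_nz: "g \<noteq> \<bottom>" using g(2) by auto
  \<comment> \<open>If \<open>g\<close> is not below \<open>\<top> - g\<close>, it lies below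
    \<open>\<top> - (\<top> - g)\<close>; then \<open>V2\<close> makes it disjoint from
    \<open>\<top> - g\<close>, and \<open>\<iota>\<close> carries this over.\<close>
  have case_top: "\<top> - g = \<top> \<or> \<iota> g \<sqinter> (\<top> - \<iota> g) = \<bottom>"
  proof (cases "g \<le> \<top> - g")
    case True
    then show ?thesis using diff_eq_self_if_le_diff by blast
  next
    case False
    then have "g \<le> \<top> - (\<top> - g)"
      using g_diff[of "\<top> - g"] closed bounds g(1) diff_mono_left[of g \<top> "\<top> - g"] by simp
    then have "g \<sqinter> (\<top> - g) \<le> (\<top> - g) \<sqinter> (\<top> - (\<top> - g))"
      by (simp add: le_infI1)
    then have "g \<sqinter> (\<top> - g) = \<bottom>"
      by (simp add: V2 bot_unique)
    then show ?thesis
      using hom closed bounds g(1) bot top by metis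
  qed
  have h0_e: "h0 (\<iota> e) = e" "h0 (\<iota> e \<sqinter> \<iota> g) = e \<sqinter> g"
    using h0(2)[OF e] h0(2)[of "e \<sqinter> g"] closed(2) hom(2) e g(1) by simp_all
  have diff_e: "g - e = g" "\<iota> g - \<iota> e = \<iota> g"
    using g_diff[OF e g(2)] hom(3)[OF g(1) e] by simp_all
  have \<iota>_g_nz: "\<iota> g \<noteq> \<bottom>"
    using inj_onD[OF inj, of g \<bottom>] bot g(1) bounds(1) g_nz by auto
  interpret join_irreducible_step h0 "\<iota> e" "\<iota> g" e g
    by (unfold_locales; fact)
  obtain h where h: "ideal_embedding (\<iota> e \<squnion> \<iota> g) h" "\<And>y. y \<le> \<iota> e \<Longrightarrow> h y = h0 y" "h (\<iota> g) = g"
    using ideal_embedding_sup by blast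
  have below_e: "h (\<iota> x) = x" if "x \<in> L0" "x \<le> e" for x
    using h(2) h0(2) embedding_on_mono[OF emb] that e by metis
  have "h (\<iota> x) = x" if x: "x \<in> L0" "x \<le> e \<squnion> g" for x
  proof -
    have xe: "h (\<iota> (x \<sqinter> e)) = x \<sqinter> e"
      using below_e closed x e by simp
    \<comment> \<open>By minimality \<open>x \<sqinter> g\<close> is \<open>g\<close> itself or lies
      below \<open>e\<close>.\<close>
    have xg: "h (\<iota> (x \<sqinter> g)) = x \<sqinter> g"
    proof (cases "x \<sqinter> g = g")
      case True then show ?thesis using h(3) by simp
    next
      case False
      then have "x \<sqinter> g < g" by (simp add: less_le)
      then show ?thesis using below_e g(3) closed(2)[OF x(1) g(1)] by simp
    qed
    have eq: "x = (x \<sqinter> e) \<squnion> (x \<sqinter> g)"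
      using x(2) by (metis inf.absorb1 inf_sup_distrib1)
    have "\<iota> (x \<sqinter> e) \<le> \<iota> e \<squnion> \<iota> g" "\<iota> (x \<sqinter> g) \<le> \<iota> e \<squnion> \<iota> g"
      using x e g hom by (auto intro: le_supI1 le_supI2)
    then have "h (\<iota> ((x \<sqinter> e) \<squnion> (x \<sqinter> g))) = (x \<sqinter> e) \<squnion> (x \<sqinter> g)"
      using ideal_embeddingD(2)[OF h(1)] xe xg hom(1) closed(2)[OF x(1) e] closed(2)[OF x(1) g(1)]
      by simp
    then show ?thesis using eq by simp
  qed
  then show ?thesis
    using h(1) hom(1)[OF e g(1)] by (intro exI[of _ h]) simp
qed

text \<open>The inclusion of \<open>L0\<close> into the finite algebra is given by
  \<open>\<iota>\<close>, so fixing the points of \<open>L0\<close> means inverting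
  \<open>\<iota>\<close> on its image.\<close>

theorem theorem5p5:
  fixes L0 :: "'a::co_heyting_V2 set"
    and \<iota> :: "'a \<Rightarrow> 'b::{co_heyting_V2, finite}"
  assumes "axiom_D2 TYPE('a)"
    and "axiom_S2 TYPE('a)"
    and "subalgebra L0"
    and "finite L0"
    and "embedding_on L0 \<iota>"
  shows "\<exists>h :: 'b \<Rightarrow> 'a. embedding_on UNIV h \<and> (\<forall>x\<in>L0. h (\<iota> x) = x)"
proof -
  let ?P = "\<lambda>e h. ideal_embedding (\<iota> e) h \<and> (\<forall>x\<in>L0. x \<le> e \<longrightarrow> h (\<iota> x) = x)"
  let ?A = "{e \<in> L0. \<exists>h :: 'b \<Rightarrow> 'a. ?P e h}"
  have bounds: "\<bottom> \<in> L0" "\<top> \<in> L0" and \<iota>: "\<iota> \<bottom> = \<bottom>" "\<iota> \<top> = \<top>"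
    using assms by (auto simp: subalgebra_def embedding_on_def)
  \<comment> \<open>On the one-point ideal below \<open>\<iota> \<bottom> = \<bottom>\<close> the
    zero map will do.\<close>
  have "?P \<bottom> (\<lambda>_. \<bottom>)"
    by (simp add: ideal_embedding_def \<iota> bot_unique diff_self_eq_bot)
  then have "?A \<noteq> {}" using bounds by blast
  moreover have "finite ?A" using assms(4) by simp
  ultimately have "\<exists>e\<in>?A. \<forall>e'\<in>?A. e \<le> e' \<longrightarrow> e = e'"
    by (rule finite_has_maximal[rotated])
  then obtain e where "e \<in> ?A" and max: "\<forall>e'\<in>?A. e \<le> e' \<longrightarrow> e = e'"
    by (rule bexE)
  from \<open>e \<in> ?A\<close> obtain h where e: "e \<in> L0" and h: "?P e h" by blast
  have "\<top> \<le> e"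
  proof (rule ccontr)
    assume "\<not> \<top> \<le> e"
    then obtain g where g: "g \<in> L0" "\<not> g \<le> e" "\<And>y. y \<in> L0 \<Longrightarrow> y < g \<Longrightarrow> y \<le> e"
      using obtain_minimal_not_le[OF assms(4) bounds(2)] by blast
    have "ideal_embedding (\<iota> e) h" "\<And>x. x \<in> L0 \<Longrightarrow> x \<le> e \<Longrightarrow> h (\<iota> x) = x"
      using h by simp_all
    then have "\<exists>h. ?P (e \<squnion> g) h"
      by (rule extend_over_join_irreducible[OF assms(1-3,5) e _ _ g])
    then have "e \<squnion> g \<in> ?A"
      using e g(1) assms(3) by (simp add: subalgebra_def)
    then show False
      using bspec[OF max, of "e \<squnion> g"] g(2) by (metis sup_ge1 sup_ge2)
  qed
  then have "e = \<top>" by (simp add: top_unique)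
  \<comment> \<open>\<open>h \<top> = \<top>\<close> is the case \<open>x = \<top>\<close> of
    inverting \<open>\<iota>\<close>.\<close>
  with h have "embedding_on UNIV h" "\<forall>x\<in>L0. h (\<iota> x) = x"
    using ideal_embedding_top_embedding_on[of h] bounds \<iota> by auto
  then show ?thesis by blast
qed

end
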